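(* Let $d=1$, $T=2$, $z_0=0$, $\mathcal{R}(v)=|v|$, $\mathcal{E}(z)=\tfrac12 z^2-z$. For $n\in\mathbb{N}$, $n\ge1$, let $$\ell_n(t)=\begin{cases}0,&t\in[0,1],\\ \tfrac n2 t-\tfrac n2,&t\in(1,1+\tfrac1n),\\ 0,&t\in[1+\tfrac1n,2],\end{cases}\qquad z_n(t)=\begin{cases}0,&t\in[0,1],\\ \tfrac n2 t-\tfrac n2,&t\in(1,1+\tfrac1n),\\ \tfrac12,&t\in[1+\tfrac1n,2],\end{cases}\qquad \tilde z(t)=\begin{cases}0,&t\in[0,1],\\ \tfrac12,&t\in(1,2].\end{cases}$$ Then: (i) $\ell_n\to0$ pointwise everywhere on $[0,2]$ and weakly$*$ in $\mathrm{BV}(0,2)$; (ii) for every $n$, $z_n\in W^{1,\infty}(0,2)$ satisfies $z_n(0)=z_0$ and $0\in\partial\mathcal R(\dot z_n(t))+D\mathcal E(z_n(t))-\ell_n(t)$ for almost all $t\in(0,2)$, and $z_n$ is a local solution associated with $\ell_n$; (iii) $z_n\to\tilde z$ pointwise on $[0,2]$; (iv) $\tilde z$ is not a local solution associated with the limit load $\ell\equiv0$. In particular, the concept of local solutions is not stable with respect to weak$*$ convergence of the loads.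
   Context: $BV([0,T])$ is the set of functions $f:[0,T]\to\mathbb{R}$ (defined everywhere) with finite pointwise total variation; $\mathrm{BV}(0,T)=\{f\in L^1(0,T):Df\in\mathfrak M(0,T)\}$ with $\mathfrak M(0,T)$ the regular Borel measures on $(0,T)$. Weak$*$ convergence $f_n\rightharpoonup^*f$ in $\mathrm{BV}(0,T)$ means $f_n\to f$ in $L^1(0,T)$ and $Df_n\rightharpoonup^*Df$ in $\mathfrak M(0,T)$. For $\ell\in BV([0,T])$ put $\mathcal I(t,z)=\mathcal E(z)-\ell(t)z$; $\partial\mathcal R$ denotes the convex subdifferential. A function $z\in BV([0,T])$ is a local solution associated with $\ell$ if $0\in\partial\mathcal R(0)+D_z\mathcal I(t,z(t))$ for almost all $t\in[0,T]$ and, for all $0\le t_1\le t_2\le T$, $$\mathcal I(t_2,z(t_2))+\mathrm{Diss}_{\mathcal R}(z;[t_1,t_2])\le\mathcal I(t_1,z(t_1))-\int_{t_1}^{t_2}z(r)\,d\ell(r),$$ where $\mathrm{Diss}_{\mathcal R}(z;[t_1,t_2])=\sup\{\sum_{i=1}^n\mathcal R(z(\xi_i)-z(\xi_{i-1})): t_1=\xi_0<\dots<\xi_n=t_2,\ n\in\mathbb N\}$ and the integral is the Kurzweil (Kurzweil–Stieltjes) integral, i.e. the gauge limit of the sums $\sum_j z(\tau_j)(\ell(x_j)-\ell(x_{j-1}))$ over tagged partitions with $\tau_j\in[x_{j-1},x_j]\subset(\tau_j-\delta(\tau_j),\tau_j+\delta(\tau_j))$, $\delta>0$ a gauge function. 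*)

theory Defs
  imports "HOL-Analysis.Analysis"
begin

definition is_partition :: "real \<Rightarrow> real \<Rightarrow> nat \<Rightarrow> (nat \<Rightarrow> real) \<Rightarrow> bool" where
  "is_partition a b n \<xi> \<longleftrightarrow> \<xi> 0 = a \<and> \<xi> n = b \<and> (\<forall>i<n. \<xi> i < \<xi> (Suc i))"

text \<open>The case \<open>n = 0\<close> is admitted, so that the dissipation on a degenerate interval is \<open>0\<close>.\<close>

definition Diss :: "(real \<Rightarrow> real) \<Rightarrow> (real \<Rightarrow> real) \<Rightarrow> real \<Rightarrow> real \<Rightarrow> ereal" where
  "Diss R z t1 t2 =
     (SUP (n, \<xi>) \<in> {(n, \<xi>). is_partition t1 t2 n \<xi>}. ereal (\<Sum>i=1..n. R (z (\<xi> i) - z (\<xi> (i - 1)))))"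

text \<open>Functions on \<open>[0,T]\<close> are total functions of which only the values on \<open>{0..T}\<close> matter. The
  pointwise total variation is the dissipation for the absolute value.\<close>

definition BV :: "real \<Rightarrow> (real \<Rightarrow> real) set" where
  "BV T = {f. Diss (\<lambda>v. \<bar>v\<bar>) f 0 T < \<infinity>}"

definition has_KS_integral ::
    "(real \<Rightarrow> real) \<Rightarrow> (real \<Rightarrow> real) \<Rightarrow> real \<Rightarrow> real \<Rightarrow> real \<Rightarrow> bool" where
  "has_KS_integral z l a b J \<longleftrightarrow>
     (\<forall>e>0. \<exists>\<delta>. (\<forall>\<tau>. 0 < \<delta> \<tau>) \<and>
        (\<forall>p. p tagged_division_of {a..b} \<and> (\<lambda>\<tau>. {\<tau> - \<delta> \<tau> <..< \<tau> + \<delta> \<tau>}) fine p \<longrightarrow>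
           \<bar>(\<Sum>(\<tau>, K)\<in>p. z \<tau> * (l (Sup K) - l (Inf K))) - J\<bar> < e))"

definition subdifferential :: "(real \<Rightarrow> real) \<Rightarrow> real \<Rightarrow> real set" where
  "subdifferential f x = {\<xi>. \<forall>y. f y \<ge> f x + \<xi> * (y - x)}"

definition energy :: "(real \<Rightarrow> real) \<Rightarrow> (real \<Rightarrow> real) \<Rightarrow> real \<Rightarrow> real \<Rightarrow> real" where
  "energy E l t z = E z - l t * z"

text \<open>For \<open>l\<close> and \<open>z\<close> in \<open>BV T\<close> the Kurzweil integral always exists; the existential quantifier
  only avoids a default value for a total integral operator.\<close>

definition local_solution ::
    "(real \<Rightarrow> real) \<Rightarrow> (real \<Rightarrow> real) \<Rightarrow> real \<Rightarrow> (real \<Rightarrow> real) \<Rightarrow> (real \<Rightarrow> real) \<Rightarrow> bool" where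
  "local_solution R E T l z \<longleftrightarrow>
     z \<in> BV T \<and>
     (AE t in lebesgue_on {0..T}.
        0 \<in> (\<lambda>\<xi>. \<xi> + deriv (energy E l t) (z t)) ` subdifferential R 0) \<and>
     (\<forall>t1 t2. 0 \<le> t1 \<and> t1 \<le> t2 \<and> t2 \<le> T \<longrightarrow>
        (\<exists>J. has_KS_integral z l t1 t2 J \<and>
             ereal (energy E l t2 (z t2)) + Diss R z t1 t2 \<le> ereal (energy E l t1 (z t1) - J)))"

definition test_functions :: "real \<Rightarrow> (real \<Rightarrow> real) set" where
  "test_functions T = {\<phi>.
     (\<forall>k x. ((deriv ^^ k) \<phi>) field_differentiable at x) \<and>
     (\<exists>a b. 0 < a \<and> b < T \<and> (\<forall>x. x \<notin> {a..b} \<longrightarrow> \<phi> x = 0))}"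

definition Linf :: "real \<Rightarrow> (real \<Rightarrow> real) set" where
  "Linf T = {f. f \<in> borel_measurable (lebesgue_on {0<..<T}) \<and>
                (\<exists>C. AE t in lebesgue_on {0<..<T}. \<bar>f t\<bar> \<le> C)}"

text \<open>\<open>f\<close> belongs to \<open>W\<^sup>1\<^sup>,\<^sup>\<infinity>(0,T)\<close> and \<open>v\<close> represents its (a.e. unique) weak derivative.\<close>

definition has_W1inf_derivative :: "real \<Rightarrow> (real \<Rightarrow> real) \<Rightarrow> (real \<Rightarrow> real) \<Rightarrow> bool" where
  "has_W1inf_derivative T f v \<longleftrightarrow> f \<in> Linf T \<and> v \<in> Linf T \<and>
     (\<forall>\<phi>\<in>test_functions T.
        (LINT t|lebesgue_on {0<..<T}. f t * deriv \<phi> t) =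
        - (LINT t|lebesgue_on {0<..<T}. v t * \<phi> t))"

text \<open>A finite signed Borel measure on \<open>(0,T)\<close> is represented, non-uniquely, as the difference of two
  finite positive Borel measures (regularity is automatic on an interval).\<close>

type_synonym signed_measure = "real measure \<times> real measure"

definition signed_measures :: "real \<Rightarrow> signed_measure set" where
  "signed_measures T = {(\<mu>, \<nu>). finite_measure \<mu> \<and> finite_measure \<nu> \<and>
     sets \<mu> = sets (restrict_space borel {0<..<T}) \<and>
     sets \<nu> = sets (restrict_space borel {0<..<T})}"

definition signed_integral :: "signed_measure \<Rightarrow> (real \<Rightarrow> real) \<Rightarrow> real" where
  "signed_integral m \<phi> = (LINT t|fst m. \<phi> t) - (LINT t|snd m. \<phi> t)"

text \<open>\<open>f\<close> belongs to the space \<open>BV(0,T)\<close> of classes of functions, and \<open>m\<close> represents \<open>Df\<close>.\<close>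

definition has_BV_derivative :: "real \<Rightarrow> (real \<Rightarrow> real) \<Rightarrow> signed_measure \<Rightarrow> bool" where
  "has_BV_derivative T f m \<longleftrightarrow>
     integrable (lebesgue_on {0<..<T}) f \<and> m \<in> signed_measures T \<and>
     (\<forall>\<phi>\<in>test_functions T.
        (LINT t|lebesgue_on {0<..<T}. f t * deriv \<phi> t) = - signed_integral m \<phi>)"

text \<open>\<open>C\<^sub>0(0,T)\<close>, whose dual is the space of finite signed Borel measures on \<open>(0,T)\<close>.\<close>

definition C0 :: "real \<Rightarrow> (real \<Rightarrow> real) set" where
  "C0 T = {\<phi>. continuous_on {0<..<T} \<phi> \<and>
     (\<forall>e>0. \<exists>K. compact K \<and> K \<subseteq> {0<..<T} \<and> (\<forall>x\<in>{0<..<T} - K. \<bar>\<phi> x\<bar> < e))}"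

definition weak_star_meas :: "real \<Rightarrow> (nat \<Rightarrow> signed_measure) \<Rightarrow> signed_measure \<Rightarrow> bool" where
  "weak_star_meas T ms m \<longleftrightarrow>
     (\<forall>\<phi>\<in>C0 T. (\<lambda>n. signed_integral (ms n) \<phi>) \<longlonglongrightarrow> signed_integral m \<phi>)"

text \<open>The integrals of \<open>C0\<close> functions do not depend on the choice of the representing pairs, so
  quantifying them existentially or universally makes no difference for \<open>fs n\<close>, \<open>f\<close> in
  \<open>BV(0,T)\<close>; the existential form also expresses this membership.\<close>

definition weak_star_BV :: "real \<Rightarrow> (nat \<Rightarrow> real \<Rightarrow> real) \<Rightarrow> (real \<Rightarrow> real) \<Rightarrow> bool" where
  "weak_star_BV T fs f \<longleftrightarrow>
     (\<exists>ms m. (\<forall>n. has_BV_derivative T (fs n) (ms n)) \<and> has_BV_derivative T f m \<and>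
        (\<lambda>n. LINT t|lebesgue_on {0<..<T}. \<bar>fs n t - f t\<bar>) \<longlonglongrightarrow> 0 \<and>
        weak_star_meas T ms m)"

definition local_solutions_weak_star_stable :: "(real \<Rightarrow> real) \<Rightarrow> (real \<Rightarrow> real) \<Rightarrow> real \<Rightarrow> bool" where
  "local_solutions_weak_star_stable R E T \<longleftrightarrow>
     (\<forall>ls l zs z.
        (\<forall>n. ls n \<in> BV T) \<and> l \<in> BV T \<and> weak_star_BV T ls l \<and>
        (\<forall>n. local_solution R E T (ls n) (zs n)) \<and>
        z \<in> BV T \<and> (\<forall>t\<in>{0..T}. (\<lambda>n. zs n t) \<longlonglongrightarrow> z t)
        \<longrightarrow> local_solution R E T l z)"

definition R_ex :: "real \<Rightarrow> real" where
  "R_ex v = \<bar>v\<bar>"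

definition E_ex :: "real \<Rightarrow> real" where
  "E_ex z = z\<^sup>2 / 2 - z"

definition load_ex :: "nat \<Rightarrow> real \<Rightarrow> real" where
  "load_ex n t = (if t \<le> 1 then 0
                  else if t < 1 + 1 / real n then real n / 2 * t - real n / 2
                  else 0)"

definition sol_ex :: "nat \<Rightarrow> real \<Rightarrow> real" where
  "sol_ex n t = (if t \<le> 1 then 0
                 else if t < 1 + 1 / real n then real n / 2 * t - real n / 2
                 else 1 / 2)"

definition lim_ex :: "real \<Rightarrow> real" where
  "lim_ex t = (if t \<le> 1 then 0 else 1 / 2)"

end

theory Submission
  imports Defs
begin

text \<open>Write \<open>z\<close> and \<open>\<ell>\<close> for the \<open>n\<close>-th solution and load and \<open>H\<close> for the indicator of \<open>[c, \<infinity>)\<close>, where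
  \<open>c = 1 + 1/n\<close> is the time at which the load drops back to \<open>0\<close>. Everything rests on the
  decomposition \<open>\<ell> = z - H/2\<close> (lemma \<open>load_ex_eq\<close>), in which \<open>z\<close> is Lipschitz and nondecreasing
  from \<open>0\<close> to \<open>1/2\<close> and \<open>z = 1/2\<close> on the support of \<open>H\<close>.

  Energy balance (\<open>sol_ex_local_solution\<close>). Since \<open>z\<close> is continuous, the integral of \<open>z\<close> against
  \<open>\<ell>\<close> obeys the chain rule: it has the primitive \<open>z\<^sup>2/2 - H/4 = \<ell> z - z\<^sup>2/2\<close>
  (\<open>KS_integral_sol_ex\<close>). As \<open>z\<close> is nondecreasing, the dissipation is the increment of \<open>z\<close>, which
  cancels the linear part of the energy, and the energy inequality becomes an identity.

  Loss of stability (\<open>lim_ex_not_local_solution\<close>). While the load ramps up, it drives the solution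
  from \<open>0\<close> to \<open>1/2\<close>; when it drops, the solution stays there. In the limit the two parts of the
  derivative of the load, mass \<open>1/2\<close> spread over \<open>(1,c)\<close> and mass \<open>-1/2\<close> at \<open>c\<close>, both concentrate
  at time \<open>1\<close>, where they cancel, so the loads converge to \<open>0\<close> weakly* although the work
  \<open>- \<integral> z d\<ell> = 1/8\<close> does not vanish. Without load the limit would have to jump from energy \<open>0\<close> to
  energy \<open>-3/8\<close> while dissipating \<open>1/2\<close>, an excess of exactly that \<open>1/8\<close>.

  Weak derivatives (\<open>LINT_mult_deriv_test\<close>). One application of the fundamental theorem of calculus
  covers both \<open>z\<close> and \<open>\<ell>\<close>, as \<open>z - s H\<close> with \<open>s = 0\<close> and \<open>s = 1/2\<close>. The weak* convergence of
  the derivatives is then the statement that the averages of a continuous function over \<open>(1,c)\<close>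
  and its values at \<open>c\<close> have the same limit.\<close>

section \<open>The approximating loads and solutions\<close>

definition jump_time :: "nat \<Rightarrow> real" where
  "jump_time n = 1 + 1 / real n"

lemmas load_ex_cases = load_ex_def[folded jump_time_def]
lemmas sol_ex_cases = sol_ex_def[folded jump_time_def]

lemma jump_time_bounds:
  assumes "n \<ge> 1"
  shows "1 < jump_time n" "jump_time n \<le> 2" "t \<le> 1 \<Longrightarrow> t < jump_time n"
proof -
  show "1 < jump_time n" "jump_time n \<le> 2"
    using assms by (auto simp: jump_time_def field_simps)
  thus "t \<le> 1 \<Longrightarrow> t < jump_time n" by linarith
qed

lemma sol_ex_eq:
  assumes "n \<ge> 1" shows "sol_ex n t = max 0 (min (1 / 2) (real n / 2 * (t - 1)))"
proof -
  have "t < jump_time n \<longleftrightarrow> real n / 2 * (t - 1) < 1 / 2"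
    using assms by (auto simp: jump_time_def field_simps)
  moreover have "t \<le> 1 \<longleftrightarrow> real n / 2 * (t - 1) \<le> 0"
    using assms by (auto simp: mult_le_0_iff)
  moreover have "real n / 2 * t - real n / 2 = real n / 2 * (t - 1)"
    by (simp add: algebra_simps)
  ultimately show ?thesis unfolding sol_ex_cases by auto
qed

lemma load_ex_eq:
  "n \<ge> 1 \<Longrightarrow> load_ex n t = sol_ex n t - indicator {jump_time n..} t / 2"
  using jump_time_bounds(3)[of n t] by (auto simp: load_ex_cases sol_ex_cases indicator_def)

lemma sol_ex_mono: "n \<ge> 1 \<Longrightarrow> u \<le> v \<Longrightarrow> sol_ex n u \<le> sol_ex n v"
  unfolding sol_ex_eq by (intro max.mono min.mono mult_left_mono) auto

lemma sol_ex_bounds: "n \<ge> 1 \<Longrightarrow> 0 \<le> sol_ex n t \<and> sol_ex n t \<le> 1 / 2"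
  by (auto simp: sol_ex_eq)

lemma sol_ex_Lipschitz:
  assumes "n \<ge> 1" shows "\<bar>sol_ex n u - sol_ex n v\<bar> \<le> real n / 2 * \<bar>u - v\<bar>"
proof -
  have "\<bar>max 0 (min (1 / 2) x) - max 0 (min (1 / 2) y)\<bar> \<le> \<bar>x - y\<bar>" for x y :: real
    by linarith
  hence "\<bar>sol_ex n u - sol_ex n v\<bar> \<le> \<bar>real n / 2 * (u - 1) - real n / 2 * (v - 1)\<bar>"
    unfolding sol_ex_eq[OF assms] .
  also have "\<dots> = real n / 2 * \<bar>u - v\<bar>"
    by (simp only: abs_mult flip: right_diff_distrib) simp
  finally show ?thesis .
qed

lemma continuous_sol_ex: "n \<ge> 1 \<Longrightarrow> continuous_on S (sol_ex n)"
  by (subst continuous_on_cong[OF refl sol_ex_eq]) (auto intro!: continuous_intros)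

section \<open>Dissipation and total variation\<close>

lemma partition_mono:
  assumes "is_partition a b n \<xi>" "i \<le> j" "j \<le> n"
  shows "\<xi> i \<le> \<xi> j"
  using assms(2,3)
proof (induction j rule: dec_induct)
  case (step j)
  with assms(1) show ?case unfolding is_partition_def
    by (meson Suc_le_eq less_eq_real_def order_trans Suc_leD)
qed simp

text \<open>Along a partition the increments of \<open>G\<close> telescope.\<close>

lemma Diss_le:
  assumes "\<And>u v. a \<le> u \<Longrightarrow> u \<le> v \<Longrightarrow> v \<le> b \<Longrightarrow> R (z v - z u) \<le> G v - G u"
  shows "Diss R z a b \<le> ereal (G b - G a)"
  unfolding Diss_def
proof (rule SUP_least, clarify)
  fix n \<xi> assume p: "is_partition a b n \<xi>"
  hence e: "\<xi> 0 = a" "\<xi> n = b" by (auto simp: is_partition_def)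
  have "(\<Sum>i=1..n. R (z (\<xi> i) - z (\<xi> (i - 1)))) \<le> (\<Sum>i=1..n. G (\<xi> i) - G (\<xi> (i - 1)))"
  proof (rule sum_mono)
    fix i assume "i \<in> {1..n}"
    hence "\<xi> 0 \<le> \<xi> (i - 1)" "\<xi> (i - 1) \<le> \<xi> i" "\<xi> i \<le> \<xi> n"
      by (auto intro!: partition_mono[OF p])
    thus "R (z (\<xi> i) - z (\<xi> (i - 1))) \<le> G (\<xi> i) - G (\<xi> (i - 1))"
      using assms e by simp
  qed
  also have "\<dots> = G (\<xi> n) - G (\<xi> 0)"
    by (induction n) auto
  finally show "ereal (\<Sum>i=1..n. R (z (\<xi> i) - z (\<xi> (i - 1)))) \<le> ereal (G b - G a)"
    using e by simp
qed

lemma Diss_ge: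
  assumes "a < b" shows "ereal (R (z b - z a)) \<le> Diss R z a b"
proof -
  have "is_partition a b 1 (\<lambda>i. if i = 0 then a else b)"
    using assms by (simp add: is_partition_def)
  thus ?thesis unfolding Diss_def
    by (intro SUP_upper2[where i="(1, \<lambda>i. if i = 0 then a else b)"]) auto
qed

lemma BV_I:
  assumes "\<And>u v. 0 \<le> u \<Longrightarrow> u \<le> v \<Longrightarrow> v \<le> T \<Longrightarrow> \<bar>f v - f u\<bar> \<le> G v - G u"
  shows "f \<in> BV T"
  using Diss_le[of 0 T "\<lambda>v. \<bar>v\<bar>" f G, OF assms] by (auto simp: BV_def less_top)

lemma load_ex_BV:
  assumes n: "n \<ge> 1" shows "load_ex n \<in> BV T"
proof (rule BV_I[where G="\<lambda>t. sol_ex n t + indicator {jump_time n..} t / 2"])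
  fix u v :: real assume "u \<le> v"
  with sol_ex_mono[OF n this]
  show "\<bar>load_ex n v - load_ex n u\<bar> \<le> sol_ex n v + indicator {jump_time n..} v / 2 -
          (sol_ex n u + indicator {jump_time n..} u / 2)"
    using \<open>u \<le> v\<close> by (auto simp: load_ex_eq[OF n] indicator_def)
qed

lemma sol_ex_BV:
  assumes n: "n \<ge> 1" shows "sol_ex n \<in> BV T"
  by (rule BV_I[where G="sol_ex n"]) (use sol_ex_mono[OF n] in auto)

section \<open>The Kurzweil integral\<close>

text \<open>For an integrator with jumps a primitive \<open>F\<close> cannot be verified by differentiation; instead
  its increments are compared with the summands of the Riemann sums. Both \<open>F\<close> and
  \<open>G\<close> telescope over a tagged division, and the error bound is uniform in the tag, so a constant gauge suffices: no tag has
  to be forced to a jump of the integrator.\<close>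

lemma has_KS_integral_if_increments:
  assumes ab: "a \<le> b"
    and incr: "\<And>d u v \<tau>. 0 < d \<Longrightarrow> u \<le> \<tau> \<Longrightarrow> \<tau> \<le> v \<Longrightarrow> v - u \<le> d \<Longrightarrow>
       \<bar>z \<tau> * (l v - l u) - (F v - F u)\<bar> \<le> d * (G v - G u)"
  shows "has_KS_integral z l a b (F b - F a)"
  unfolding has_KS_integral_def
proof (intro allI impI)
  fix e :: real assume e: "e > 0"
  define d where "d = e / (\<bar>G b - G a\<bar> + 1)"
  have d: "d > 0" using e by (simp add: d_def)
  show "\<exists>\<delta>. (\<forall>\<tau>. 0 < \<delta> \<tau>) \<and> (\<forall>p. p tagged_division_of {a..b} \<and>
          (\<lambda>\<tau>. {\<tau> - \<delta> \<tau><..<\<tau> + \<delta> \<tau>}) fine p \<longrightarrow>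
          \<bar>(\<Sum>(\<tau>, K)\<in>p. z \<tau> * (l (Sup K) - l (Inf K))) - (F b - F a)\<bar> < e)"
  proof (intro exI[of _ "\<lambda>_. d / 2"] conjI allI impI)
    show "0 < d / 2" using d by simp
    fix p assume "p tagged_division_of {a..b} \<and> (\<lambda>\<tau>. {\<tau> - d / 2<..<\<tau> + d / 2}) fine p"
    hence p: "p tagged_division_of {a..b}"
      and fine: "\<And>x K. (x, K) \<in> p \<Longrightarrow> K \<subseteq> {x - d / 2<..<x + d / 2}"
      by (auto simp: fine_def)
    have "\<bar>(\<Sum>(\<tau>, K)\<in>p. z \<tau> * (l (Sup K) - l (Inf K))) - (F b - F a)\<bar>
        = \<bar>\<Sum>(\<tau>, K)\<in>p. z \<tau> * (l (Sup K) - l (Inf K)) - (F (Sup K) - F (Inf K))\<bar>"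
      unfolding additive_tagged_division_1[OF ab p, symmetric, of F]
      by (simp add: sum_subtractf case_prod_unfold)
    also have "\<dots> \<le> (\<Sum>(\<tau>, K)\<in>p. \<bar>z \<tau> * (l (Sup K) - l (Inf K)) - (F (Sup K) - F (Inf K))\<bar>)"
      unfolding case_prod_unfold by (rule sum_abs)
    also have "\<dots> \<le> (\<Sum>(\<tau>, K)\<in>p. d * (G (Sup K) - G (Inf K)))"
    proof (rule sum_mono, clarify)
      fix x K assume xK: "(x, K) \<in> p"
      obtain u v where K: "K = {u..v}" and x: "x \<in> K"
        using tagged_division_ofD(2,4)[OF p xK] by auto
      have "u \<in> {x - d / 2<..<x + d / 2}" "v \<in> {x - d / 2<..<x + d / 2}"
        using fine[OF xK] K x by fastforce+
      thus "\<bar>z x * (l (Sup K) - l (Inf K)) - (F (Sup K) - F (Inf K))\<bar> \<le> d * (G (Sup K) - G (Inf K))"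
        using incr[OF d, of u x v] K x by auto
    qed
    also have "\<dots> = d * (G b - G a)"
      unfolding additive_tagged_division_1[OF ab p, symmetric, of G]
      by (simp add: sum_distrib_left case_prod_unfold)
    also have "\<dots> \<le> d * \<bar>G b - G a\<bar>" using d by simp
    also have "\<dots> < d * (\<bar>G b - G a\<bar> + 1)" using d by simp
    also have "\<dots> = e" by (simp add: d_def)
    finally show "\<bar>(\<Sum>(\<tau>, K)\<in>p. z \<tau> * (l (Sup K) - l (Inf K))) - (F b - F a)\<bar> < e" .
  qed
qed

text \<open>All Riemann sums vanish, but this determines \<open>J\<close> only because every gauge admits a fine
  tagged division (Cousin's lemma).\<close>

lemma has_KS_integral_zero_load:
  assumes "has_KS_integral z (\<lambda>t. 0) a b J"
  shows "J = 0"
proof (rule ccontr)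
  assume "J \<noteq> 0"
  hence "0 < \<bar>J\<bar>" by simp
  from assms[unfolded has_KS_integral_def, rule_format, OF this]
  obtain \<delta> where \<delta>: "\<And>\<tau>. 0 < \<delta> \<tau>" and
    fine: "\<And>p. p tagged_division_of {a..b} \<Longrightarrow> (\<lambda>\<tau>. {\<tau> - \<delta> \<tau> <..< \<tau> + \<delta> \<tau>}) fine p \<Longrightarrow>
             \<bar>(\<Sum>(\<tau>, K)\<in>p. z \<tau> * (0 - 0)) - J\<bar> < \<bar>J\<bar>"
    by blast
  have "gauge (\<lambda>\<tau>. {\<tau> - \<delta> \<tau> <..< \<tau> + \<delta> \<tau>})"
    using \<delta> by (auto simp: gauge_def)
  then obtain p where "p tagged_division_of {a..b}" "(\<lambda>\<tau>. {\<tau> - \<delta> \<tau> <..< \<tau> + \<delta> \<tau>}) fine p"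
    by (rule fine_division_exists_real)
  from fine[OF this] show False by simp
qed

text \<open>The integrator splits as \<open>z - H/2\<close>. For the part \<open>z dz\<close> the difference between
  a summand and the increment of \<open>z\<^sup>2/2\<close> is \<open>z v - z u\<close> times \<open>z \<tau> - (z u + z v)/2\<close>, hence bounded by \<open>L\<^sup>2 (v - u) d\<close>; for the jump part
  the tag may miss the jump time by at most \<open>d\<close>, which costs \<open>L d\<close> times the increment of \<open>H/2\<close>.
  This gives the controlling function \<open>G = L\<^sup>2 t + L H/2\<close>.\<close>

lemma KS_integral_sol_ex:
  assumes n: "n \<ge> 1" and ab: "a \<le> b"
  defines "F \<equiv> \<lambda>t. load_ex n t * sol_ex n t - (sol_ex n t)\<^sup>2 / 2"
  shows "has_KS_integral (sol_ex n) (load_ex n) a b (F b - F a)"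
proof (rule has_KS_integral_if_increments[OF ab, where
      G="\<lambda>t. real n / 2 * (real n / 2 * t) + real n / 2 * (indicator {jump_time n..} t / 2)"])
  fix d u v \<tau> :: real
  assume d: "0 < d" and \<tau>: "u \<le> \<tau>" "\<tau> \<le> v" and uv: "v - u \<le> d"
  define z H L where "z = sol_ex n" and "H = (indicator {jump_time n..} :: real \<Rightarrow> real)"
    and "L = real n / 2"
  have L: "0 \<le> L" by (simp add: L_def)
  have Lip: "\<bar>z x - z y\<bar> \<le> L * d" if "x \<in> {u..v}" "y \<in> {u..v}" for x y
  proof -
    have "\<bar>z x - z y\<bar> \<le> L * \<bar>x - y\<bar>" unfolding z_def L_def by (rule sol_ex_Lipschitz[OF n])
    also have "\<dots> \<le> L * d" using that uv L by (intro mult_left_mono) auto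
    finally show ?thesis .
  qed
  \<comment> \<open>The continuous integrand has the value \<open>1/2\<close> at the jump and stays there.\<close>
  have Hz: "H t * z t = H t / 2" for t
    using jump_time_bounds(3)[OF n, of t] by (auto simp: H_def z_def sol_ex_cases indicator_def)
  have F: "F t = (z t)\<^sup>2 / 2 - H t / 4" for t
    using Hz[of t] unfolding F_def load_ex_eq[OF n] z_def[symmetric] H_def[symmetric]
    by (simp add: algebra_simps power2_eq_square)
  have "z \<tau> * (load_ex n v - load_ex n u) - (F v - F u)
      = (z v - z u) * (z \<tau> - (z u + z v) / 2) - (z \<tau> - 1 / 2) * (H v - H u) / 2"
    unfolding F load_ex_eq[OF n] z_def[symmetric] H_def[symmetric]
    by (simp add: field_simps power2_eq_square)
  also have "\<bar>\<dots>\<bar> \<le> \<bar>(z v - z u) * (z \<tau> - (z u + z v) / 2)\<bar> + \<bar>(z \<tau> - 1 / 2) * (H v - H u) / 2\<bar>"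
    by (rule abs_triangle_ineq4)
  also have "\<dots> \<le> (L * (v - u)) * (L * d) + (L * d) * (H v - H u) / 2"
  proof (rule add_mono)
    show "\<bar>(z v - z u) * (z \<tau> - (z u + z v) / 2)\<bar> \<le> (L * (v - u)) * (L * d)"
      unfolding abs_mult
    proof (rule mult_mono)
      show "\<bar>z v - z u\<bar> \<le> L * (v - u)"
        using sol_ex_Lipschitz[OF n, of v u] \<tau> by (simp add: z_def L_def)
      show "\<bar>z \<tau> - (z u + z v) / 2\<bar> \<le> L * d"
        using Lip[of \<tau> u] Lip[of \<tau> v] \<tau> by (auto simp: abs_le_iff field_simps)
    qed (use \<tau> L in auto)
    show "\<bar>(z \<tau> - 1 / 2) * (H v - H u) / 2\<bar> \<le> (L * d) * (H v - H u) / 2"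
    proof (cases "jump_time n \<in> {u..v}")
      case True
      have "z (jump_time n) = 1 / 2" using jump_time_bounds(1)[OF n] by (simp add: z_def sol_ex_cases)
      with Lip[of \<tau> "jump_time n"] True \<tau> have "\<bar>z \<tau> - 1 / 2\<bar> \<le> L * d" by auto
      moreover have "H u \<le> H v" using \<tau> by (auto simp: H_def indicator_def)
      ultimately show ?thesis by (auto simp: abs_mult intro: mult_right_mono)
    next
      case False
      hence "H u = H v" using \<tau> by (auto simp: H_def indicator_def)
      thus ?thesis by simp
    qed
  qed
  also have "\<dots> = d * (L * (L * v) + L * (H v / 2) - (L * (L * u) + L * (H u / 2)))"
    by (simp add: field_simps)
  finally show "\<bar>sol_ex n \<tau> * (load_ex n v - load_ex n u) - (F v - F u)\<bar> \<le>
      d * (real n / 2 * (real n / 2 * v) + real n / 2 * (indicator {jump_time n..} v / 2) -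
           (real n / 2 * (real n / 2 * u) + real n / 2 * (indicator {jump_time n..} u / 2)))"
    unfolding z_def[symmetric] H_def[symmetric] L_def[symmetric] .
qed

section \<open>Local solutions\<close>

lemma E_ex_deriv: "deriv E_ex z = z - 1"
  unfolding E_ex_def by (rule DERIV_imp_deriv) (auto intro!: derivative_eq_intros)

lemma energy_ex_deriv: "deriv (energy E_ex l t) z = z - 1 - l t"
  unfolding E_ex_def energy_def[abs_def]
  by (rule DERIV_imp_deriv) (auto intro!: derivative_eq_intros)

lemma subdifferential_R_ex_0: "\<bar>\<xi>\<bar> \<le> 1 \<Longrightarrow> \<xi> \<in> subdifferential R_ex 0"
proof -
  assume "\<bar>\<xi>\<bar> \<le> 1"
  hence "\<xi> * y \<le> \<bar>y\<bar>" for y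
    by (metis abs_ge_self abs_mult abs_ge_zero mult_left_le_one_le order_trans)
  thus ?thesis by (simp add: subdifferential_def R_ex_def)
qed

lemma subdifferential_R_ex_pos: "0 < v \<Longrightarrow> 1 \<in> subdifferential R_ex v"
  by (auto simp: subdifferential_def R_ex_def)

text \<open>The stability condition amounts to \<open>\<bar>1 + \<ell> - z\<bar> \<le> 1\<close>, where \<open>1 + \<ell> - z = 1 - H/2\<close>.\<close>

lemma sol_ex_local_solution:
  assumes n: "n \<ge> 1" shows "local_solution R_ex E_ex T (load_ex n) (sol_ex n)"
  unfolding local_solution_def
proof (intro conjI allI impI)
  show "sol_ex n \<in> BV T" by (rule sol_ex_BV[OF n])
  have "0 \<in> (\<lambda>\<xi>. \<xi> + deriv (energy E_ex (load_ex n) t) (sol_ex n t)) ` subdifferential R_ex 0" for t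
    by (rule image_eqI[of _ _ "1 + load_ex n t - sol_ex n t"])
      (auto simp: energy_ex_deriv load_ex_eq[OF n] indicator_def intro!: subdifferential_R_ex_0)
  thus "AE t in lebesgue_on {0..T}.
      0 \<in> (\<lambda>\<xi>. \<xi> + deriv (energy E_ex (load_ex n) t) (sol_ex n t)) ` subdifferential R_ex 0"
    by simp
next
  fix t1 t2 :: real assume t: "0 \<le> t1 \<and> t1 \<le> t2 \<and> t2 \<le> T"
  let ?F = "\<lambda>t. load_ex n t * sol_ex n t - (sol_ex n t)\<^sup>2 / 2"
  have "Diss R_ex (sol_ex n) t1 t2 \<le> ereal (sol_ex n t2 - sol_ex n t1)"
    by (rule Diss_le) (use sol_ex_mono[OF n] in \<open>auto simp: R_ex_def\<close>)
  hence "ereal (energy E_ex (load_ex n) t2 (sol_ex n t2)) + Diss R_ex (sol_ex n) t1 t2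
       \<le> ereal (energy E_ex (load_ex n) t2 (sol_ex n t2)) + ereal (sol_ex n t2 - sol_ex n t1)"
    by (rule add_left_mono)
  also have "\<dots> = ereal (energy E_ex (load_ex n) t1 (sol_ex n t1) - (?F t2 - ?F t1))"
    by (simp add: energy_def E_ex_def)
  finally show "\<exists>J. has_KS_integral (sol_ex n) (load_ex n) t1 t2 J \<and>
      ereal (energy E_ex (load_ex n) t2 (sol_ex n t2)) + Diss R_ex (sol_ex n) t1 t2
      \<le> ereal (energy E_ex (load_ex n) t1 (sol_ex n t1) - J)"
    using KS_integral_sol_ex[OF n, of t1 t2] t by blast
qed

lemma lim_ex_BV: "lim_ex \<in> BV T"
  by (rule BV_I[where G=lim_ex]) (auto simp: lim_ex_def)

text \<open>On \<open>[1,2]\<close> the energy inequality would read \<open>-3/8 + 1/2 \<le> 0\<close>, as the limit still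
  has the value \<open>0\<close> at time \<open>1\<close>.\<close>

lemma lim_ex_not_local_solution: "\<not> local_solution R_ex E_ex 2 (\<lambda>t. 0) lim_ex"
proof
  assume "local_solution R_ex E_ex 2 (\<lambda>t. 0) lim_ex"
  then obtain J where J: "has_KS_integral lim_ex (\<lambda>t. 0) 1 2 J"
    and le: "ereal (energy E_ex (\<lambda>t. 0) 2 (lim_ex 2)) + Diss R_ex lim_ex 1 2
      \<le> ereal (energy E_ex (\<lambda>t. 0) 1 (lim_ex 1) - J)"
    unfolding local_solution_def by (smt (verit))
  have "ereal (1 / 2) \<le> Diss R_ex lim_ex 1 2"
    using Diss_ge[of 1 2 R_ex lim_ex] by (simp add: R_ex_def lim_ex_def)
  hence "ereal (energy E_ex (\<lambda>t. 0) 2 (lim_ex 2)) + ereal (1 / 2)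
      \<le> ereal (energy E_ex (\<lambda>t. 0) 1 (lim_ex 1) - J)"
    using le by (meson add_left_mono order_trans)
  thus False
    using has_KS_integral_zero_load[OF J]
    by (simp add: energy_def E_ex_def lim_ex_def power2_eq_square)
qed

section \<open>Pointwise limits\<close>

lemma jump_time_tendsto: "(\<lambda>n. jump_time (Suc n)) \<longlonglongrightarrow> 1"
  unfolding jump_time_def using tendsto_add[OF tendsto_const LIMSEQ_Suc[OF lim_1_over_n]] by fastforce

lemma eventually_jump_time_less:
  "1 < t \<Longrightarrow> eventually (\<lambda>n. jump_time (Suc n) < t) sequentially"
  using jump_time_tendsto by (rule order_tendstoD)

lemma load_ex_tendsto: "(\<lambda>n. load_ex (Suc n) t) \<longlonglongrightarrow> 0"
proof (cases "t \<le> 1")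
  case False
  hence "eventually (\<lambda>n. jump_time (Suc n) < t) sequentially"
    by (intro eventually_jump_time_less) simp
  hence "eventually (\<lambda>n. load_ex (Suc n) t = 0) sequentially"
    by eventually_elim (simp add: load_ex_cases)
  thus ?thesis by (rule tendsto_eventually)
qed (simp add: load_ex_cases)

lemma sol_ex_tendsto: "(\<lambda>n. sol_ex (Suc n) t) \<longlonglongrightarrow> lim_ex t"
proof (cases "t \<le> 1")
  case False
  hence "eventually (\<lambda>n. jump_time (Suc n) < t) sequentially"
    by (intro eventually_jump_time_less) simp
  hence "eventually (\<lambda>n. sol_ex (Suc n) t = lim_ex t) sequentially"
    by eventually_elim (use False in \<open>simp add: sol_ex_cases lim_ex_def\<close>)
  thus ?thesis by (rule tendsto_eventually)
qed (simp add: sol_ex_cases lim_ex_def)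

section \<open>Weak derivatives\<close>

definition sol_ex_deriv :: "nat \<Rightarrow> real \<Rightarrow> real" where
  "sol_ex_deriv n t = real n / 2 * indicator {1<..<jump_time n} t"

lemma borel_measurable_sol_ex_deriv: "sol_ex_deriv n \<in> borel_measurable borel"
  unfolding sol_ex_deriv_def[abs_def] by measurable

lemma sol_ex_has_derivative:
  assumes "n \<ge> 1" "t \<noteq> 1" "t \<noteq> jump_time n"
  shows "(sol_ex n has_real_derivative sol_ex_deriv n t) (at t)"
proof -
  consider "t < 1" | "1 < t" "t < jump_time n" | "jump_time n < t" using assms by linarith
  thus ?thesis
  proof cases
    case 1
    have "((\<lambda>_. 0) has_real_derivative sol_ex_deriv n t) (at t)"
      using 1 by (auto simp: sol_ex_deriv_def)
    thus ?thesis
      by (rule has_field_derivative_transform_within_open[where S="{..<1}"])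
        (use 1 in \<open>auto simp: sol_ex_cases\<close>)
  next
    case 2
    have "((\<lambda>t. real n / 2 * t - real n / 2) has_real_derivative sol_ex_deriv n t) (at t)"
      using 2 by (auto simp: sol_ex_deriv_def intro!: derivative_eq_intros)
    thus ?thesis
      by (rule has_field_derivative_transform_within_open[where S="{1<..<jump_time n}"])
        (use 2 in \<open>auto simp: sol_ex_cases\<close>)
  next
    case 3
    have "((\<lambda>_. 1 / 2) has_real_derivative sol_ex_deriv n t) (at t)"
      using 3 by (auto simp: sol_ex_deriv_def)
    thus ?thesis
      by (rule has_field_derivative_transform_within_open[where S="{jump_time n<..}"])
        (use 3 jump_time_bounds(1)[OF assms(1)] in \<open>auto simp: sol_ex_cases\<close>)
  qed
qed

lemma test_functionsD:
  assumes "\<phi> \<in> test_functions T"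
  shows "(\<phi> has_real_derivative deriv \<phi> x) (at x)"
    and "continuous_on S \<phi>" and "continuous_on S (deriv \<phi>)" and "x \<le> 0 \<or> T \<le> x \<Longrightarrow> \<phi> x = 0"
proof -
  have fd: "((deriv ^^ k) \<phi>) field_differentiable at x" for k x
    using assms by (auto simp: test_functions_def)
  from fd[of 0] show "(\<phi> has_real_derivative deriv \<phi> x) (at x)" for x
    by (simp add: DERIV_deriv_iff_field_differentiable)
  have "continuous_on S ((deriv ^^ k) \<phi>)" for k
    by (intro continuous_at_imp_continuous_on ballI field_differentiable_imp_continuous_at fd)
  from this[of 0] this[of 1] show "continuous_on S \<phi>" "continuous_on S (deriv \<phi>)" by simp_all
  show "x \<le> 0 \<or> T \<le> x \<Longrightarrow> \<phi> x = 0"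
    using assms by (force simp: test_functions_def)
qed

lemma integrable_indicator_continuous:
  fixes f :: "real \<Rightarrow> real"
  assumes "continuous_on UNIV f" "A \<in> sets borel"
  shows "integrable (lebesgue_on {a<..<b}) (\<lambda>t. indicator A t * f t)"
proof -
  have "f absolutely_integrable_on {a..b}"
    by (intro absolutely_integrable_continuous_real continuous_on_subset[OF assms(1)]) simp
  hence "f absolutely_integrable_on ({a<..<b} \<inter> A)"
    by (rule set_integrable_subset) (use assms in auto)
  thus ?thesis
    by (simp add: integrable_restrict_space set_integrable_def indicator_inter_arith mult.assoc)
qed

lemma has_integral_sol_ex_deriv_mult:
  assumes "n \<ge> 1" "continuous_on {1..jump_time n} \<phi>"
  shows "((\<lambda>t. sol_ex_deriv n t * \<phi> t) has_integral (real n / 2 * integral {1..jump_time n} \<phi>)) {0..2}"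
proof -
  have "(\<phi> has_integral integral {1..jump_time n} \<phi>) {1<..<jump_time n}"
    using assms(2) by (simp add: integrable_continuous_real integrable_integral flip: has_integral_Icc_iff_Ioo)
  hence "((\<lambda>t. real n / 2 * \<phi> t) has_integral (real n / 2 * integral {1..jump_time n} \<phi>)) {1<..<jump_time n}"
    by (rule has_integral_mult_right)
  moreover have "{1<..<jump_time n} \<subseteq> {0..2}" using jump_time_bounds[OF assms(1)] by auto
  ultimately have "((\<lambda>t. if t \<in> {1<..<jump_time n} then real n / 2 * \<phi> t else 0) has_integral
      (real n / 2 * integral {1..jump_time n} \<phi>)) {0..2}"
    by (simp only: has_integral_restrict)
  thus ?thesis
    by (rule has_integral_eq[rotated]) (auto simp: sol_ex_deriv_def)
qed

lemma LINT_sol_ex_deriv_mult: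
  assumes "n \<ge> 1" "continuous_on UNIV \<phi>"
  shows "(LINT t|lebesgue_on {0<..<2}. sol_ex_deriv n t * \<phi> t) = real n / 2 * integral {1..jump_time n} \<phi>"
proof -
  have "integrable (lebesgue_on {0<..<2}) (\<lambda>t. sol_ex_deriv n t * \<phi> t)"
    using integrable_mult_right[of "real n / 2",
        OF integrable_indicator_continuous[OF assms(2), of "{1<..<jump_time n}" 0 2]]
    by (simp add: sol_ex_deriv_def mult.assoc)
  hence "(LINT t|lebesgue_on {0<..<2}. sol_ex_deriv n t * \<phi> t) = integral {0..2} (\<lambda>t. sol_ex_deriv n t * \<phi> t)"
    by (simp add: lebesgue_integral_eq_integral integral_open_interval_real)
  also have "\<dots> = real n / 2 * integral {1..jump_time n} \<phi>"
    by (intro integral_unique has_integral_sol_ex_deriv_mult assms(1)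
        continuous_on_subset[OF assms(2)]) simp
  finally show ?thesis .
qed

text \<open>Integration by parts. The product \<open>H \<phi>\<close> jumps at \<open>c\<close>, but its corrected version
  \<open>H (\<phi> - \<phi> c)\<close>, written without \<open>H\<close> as \<open>\<phi> (max t c) - \<phi> c\<close>, is continuous with the same
  derivative off \<open>c\<close>; the correction produces the point evaluation \<open>s \<phi> c\<close>.
  For \<open>n = 1\<close> the jump sits on the boundary, \<open>c = 2\<close>, where \<open>\<phi>\<close> vanishes.\<close>

lemma LINT_mult_deriv_test:
  fixes s :: real
  assumes n: "n \<ge> 1" and \<phi>: "\<phi> \<in> test_functions 2"
  defines "w \<equiv> \<lambda>t. sol_ex n t - s * indicator {jump_time n..} t"
  shows "(LINT t|lebesgue_on {0<..<2}. w t * deriv \<phi> t) =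
    s * \<phi> (jump_time n) - real n / 2 * integral {1..jump_time n} \<phi>"
proof -
  define c where "c = jump_time n"
  have c: "1 < c" "c \<le> 2" using jump_time_bounds(1,2)[OF n] by (simp_all add: c_def)
  note \<phi>' = test_functionsD[OF \<phi>]
  define \<psi> where "\<psi> t = sol_ex n t * \<phi> t - s * (\<phi> (max t c) - \<phi> c)" for t
  have "((\<lambda>t. w t * deriv \<phi> t + sol_ex_deriv n t * \<phi> t) has_integral (\<psi> 2 - \<psi> 0)) {0..2}"
  proof (rule fundamental_theorem_of_calculus_interior_strong[where S="{1, c}"])
    show "continuous_on {0..2} \<psi>"
      unfolding \<psi>_def
      by (intro continuous_intros continuous_sol_ex n \<phi>' continuous_on_compose2[OF \<phi>'(2)[of UNIV]]) auto
    fix t :: real assume t: "t \<in> {0<..<2} - {1, c}"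
    have "((\<lambda>t. \<phi> (max t c)) has_real_derivative indicator {c..} t * deriv \<phi> t) (at t)"
    proof (cases "t < c")
      case True
      have "((\<lambda>_. \<phi> c) has_real_derivative indicator {c..} t * deriv \<phi> t) (at t)"
        using True by simp
      thus ?thesis
        by (rule has_field_derivative_transform_within_open[where S="{..<c}"]) (use True in auto)
    next
      case False
      have "(\<phi> has_real_derivative indicator {c..} t * deriv \<phi> t) (at t)"
        using False \<phi>'(1) by simp
      thus ?thesis
        by (rule has_field_derivative_transform_within_open[where S="{c<..}"]) (use False t in auto)
    qed
    moreover have "(sol_ex n has_real_derivative sol_ex_deriv n t) (at t)"
      by (rule sol_ex_has_derivative) (use n t in \<open>auto simp: c_def\<close>)
    ultimately have "(\<psi> has_real_derivative (w t * deriv \<phi> t + sol_ex_deriv n t * \<phi> t)) (at t)"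
      unfolding \<psi>_def w_def c_def[symmetric]
      by (auto intro!: derivative_eq_intros \<phi>'(1) simp: algebra_simps)
    thus "(\<psi> has_vector_derivative (w t * deriv \<phi> t + sol_ex_deriv n t * \<phi> t)) (at t)"
      by (simp add: has_real_derivative_iff_has_vector_derivative)
  qed auto
  moreover have "\<psi> 2 - \<psi> 0 = s * \<phi> c"
    using \<phi>'(4)[of 0] \<phi>'(4)[of 2] c by (simp add: \<psi>_def)
  ultimately have "((\<lambda>t. w t * deriv \<phi> t) has_integral
      (s * \<phi> c - real n / 2 * integral {1..jump_time n} \<phi>)) {0..2}"
    using has_integral_diff[OF _ has_integral_sol_ex_deriv_mult[OF n \<phi>'(2)]] by fastforce
  moreover have "integrable (lebesgue_on {0<..<2})
      (\<lambda>t. indicator UNIV t * (sol_ex n t * deriv \<phi> t) - s * (indicator {jump_time n..} t * deriv \<phi> t))"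
    by (intro Bochner_Integration.integrable_diff integrable_mult_right integrable_indicator_continuous
        continuous_intros continuous_sol_ex n \<phi>') auto
  hence "integrable (lebesgue_on {0<..<2}) (\<lambda>t. w t * deriv \<phi> t)"
    by (simp add: w_def algebra_simps)
  ultimately show ?thesis
    by (simp add: lebesgue_integral_eq_integral integral_unique c_def flip: integral_open_interval_real)
qed

lemma borel_measurable_lebesgue_on:
  "f \<in> borel_measurable borel \<Longrightarrow> f \<in> borel_measurable (lebesgue_on S)"
  by (intro measurable_restrict_space1 measurable_completion) simp

lemma sol_ex_W1inf:
  assumes n: "n \<ge> 1"
  shows "has_W1inf_derivative 2 (sol_ex n) (sol_ex_deriv n)"
  unfolding has_W1inf_derivative_def
proof (intro conjI ballI)
  have "\<bar>sol_ex n t\<bar> \<le> 1 / 2" for t using sol_ex_bounds[OF n, of t] by auto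
  moreover have "sol_ex n \<in> borel_measurable borel"
    by (intro borel_measurable_continuous_onI continuous_sol_ex n)
  ultimately show "sol_ex n \<in> Linf 2"
    unfolding Linf_def by (auto intro!: exI[of _ "1 / 2"] borel_measurable_lebesgue_on)
  have "\<bar>sol_ex_deriv n t\<bar> \<le> real n / 2" for t by (simp add: sol_ex_deriv_def indicator_def)
  thus "sol_ex_deriv n \<in> Linf 2"
    unfolding Linf_def using borel_measurable_sol_ex_deriv by (auto intro!: exI[of _ "real n / 2"] borel_measurable_lebesgue_on)
next
  fix \<phi> assume \<phi>: "\<phi> \<in> test_functions 2"
  show "(LINT t|lebesgue_on {0<..<2}. sol_ex n t * deriv \<phi> t) =
      - (LINT t|lebesgue_on {0<..<2}. sol_ex_deriv n t * \<phi> t)"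
    using LINT_mult_deriv_test[OF n \<phi>, of 0] LINT_sol_ex_deriv_mult[OF n test_functionsD(2)[OF \<phi>]]
    by simp
qed

text \<open>The element of the subdifferential is \<open>1 + \<ell> - z\<close>. It equals \<open>1\<close> before \<open>c\<close>, in particular
  while \<open>z\<close> grows, and \<open>1/2\<close> afterwards, when \<open>z\<close> is at rest. With this representative of the
  derivative the inclusion holds even at the kinks of \<open>z\<close>.\<close>

lemma sol_ex_inclusion:
  assumes n: "n \<ge> 1"
  shows "0 \<in> (\<lambda>\<xi>. \<xi> + deriv E_ex (sol_ex n t) - load_ex n t) ` subdifferential R_ex (sol_ex_deriv n t)"
proof (rule image_eqI[of _ _ "1 + load_ex n t - sol_ex n t"])
  show "1 + load_ex n t - sol_ex n t \<in> subdifferential R_ex (sol_ex_deriv n t)"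
  proof (cases "t \<in> {1<..<jump_time n}")
    case True
    thus ?thesis using n
      by (auto simp: load_ex_eq sol_ex_deriv_def intro!: subdifferential_R_ex_pos)
  next
    case False
    thus ?thesis using n
      by (auto simp: load_ex_eq sol_ex_deriv_def indicator_def intro!: subdifferential_R_ex_0)
  qed
qed (simp add: E_ex_deriv)

text \<open>The atom is intersected with \<open>(0,2)\<close> because for \<open>n = 1\<close> the load drops at the end point \<open>2\<close>,
  which its derivative as a measure on \<open>(0,2)\<close> does not see.\<close>

definition load_ex_deriv :: "nat \<Rightarrow> signed_measure" where
  "load_ex_deriv n =
    (density (restrict_space lborel {0<..<2}) (\<lambda>t. ennreal (sol_ex_deriv n t)),
     distr (point_measure ({jump_time n} \<inter> {0<..<2}) (\<lambda>_. ennreal (1 / 2))) (restrict_space borel {0<..<2}) (\<lambda>t. t))"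

lemma load_ex_deriv_signed_measure: "load_ex_deriv n \<in> signed_measures 2"
proof -
  have "(\<integral>\<^sup>+ t. ennreal (sol_ex_deriv n t) \<partial>restrict_space lborel {0<..<2})
      \<le> (\<integral>\<^sup>+ t. ennreal (real n / 2) \<partial>restrict_space lborel {0<..<2::real})"
    by (intro nn_integral_mono ennreal_leI) (simp add: sol_ex_deriv_def indicator_def)
  also have "\<dots> < \<infinity>"
    by (simp add: emeasure_restrict_space ennreal_mult_less_top)
  finally have "(\<integral>\<^sup>+ t. ennreal (sol_ex_deriv n t) \<partial>restrict_space lborel {0<..<2}) < \<infinity>" .
  moreover have "(\<lambda>t. ennreal (sol_ex_deriv n t)) \<in> borel_measurable (restrict_space lborel {0<..<2})"
    by (intro measurable_restrict_space1 measurable_compose[OF _ measurable_ennreal])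
      (simp add: borel_measurable_sol_ex_deriv)
  moreover from this have "emeasure (fst (load_ex_deriv n)) (space (fst (load_ex_deriv n)))
      = (\<integral>\<^sup>+ t. ennreal (sol_ex_deriv n t) \<partial>restrict_space lborel {0<..<2})"
    unfolding load_ex_deriv_def fst_conv space_density
    by (subst emeasure_density[OF _ sets.top]) (auto intro!: nn_integral_cong)
  ultimately have "finite_measure (fst (load_ex_deriv n))"
    by (intro finite_measureI) simp
  moreover have "finite_measure (snd (load_ex_deriv n))"
    unfolding load_ex_deriv_def snd_conv
  proof (rule finite_measure.finite_measure_distr)
    show "finite_measure (point_measure ({jump_time n} \<inter> {0<..<2}) (\<lambda>_. ennreal (1 / 2)))"
      by (rule finite_measureI)
        (simp add: emeasure_point_measure_finite space_point_measure ennreal_mult_eq_top_iff)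
    show "(\<lambda>t. t) \<in> point_measure ({jump_time n} \<inter> {0<..<2}) (\<lambda>_. ennreal (1 / 2)) \<rightarrow>\<^sub>M restrict_space borel {0<..<2}"
      by (auto simp: measurable_def space_point_measure sets_point_measure space_restrict_space)
  qed
  ultimately show ?thesis
    by (auto simp: signed_measures_def load_ex_deriv_def intro!: sets_restrict_space_cong)
qed

lemma signed_integral_load_ex_deriv:
  assumes n: "n \<ge> 1" and \<phi>: "continuous_on {0<..<2} \<phi>" "continuous_on {1..jump_time n} \<phi>"
  shows "signed_integral (load_ex_deriv n) \<phi> =
    real n / 2 * integral {1..jump_time n} \<phi> - (if jump_time n < 2 then \<phi> (jump_time n) / 2 else 0)"
proof -
  have meas: "\<phi> \<in> borel_measurable (restrict_space borel {0<..<2})"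
    by (rule borel_measurable_continuous_on_restrict[OF \<phi>(1)])
  hence meas': "\<phi> \<in> borel_measurable (restrict_space lborel {0<..<2})"
    by (simp cong: measurable_cong_sets sets_restrict_space_cong)
  have "(LINT t|fst (load_ex_deriv n). \<phi> t) =
      (LINT t|restrict_space lborel {0<..<2}. sol_ex_deriv n t *\<^sub>R \<phi> t)"
    unfolding load_ex_deriv_def fst_conv
    by (rule integral_density[OF meas']) (auto simp: sol_ex_deriv_def
        intro!: measurable_restrict_space1 borel_measurable_sol_ex_deriv)
  also have "\<dots> = (LINT t|lborel. indicator {0<..<2} t *\<^sub>R (sol_ex_deriv n t *\<^sub>R \<phi> t))"
    by (rule integral_restrict_space) simp
  also have "\<dots> = (LINT t|lborel. real n / 2 * (indicator {1<..<jump_time n} t *\<^sub>R \<phi> t))"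
    by (rule Bochner_Integration.integral_cong[OF refl])
      (use jump_time_bounds(2)[OF n] in \<open>auto simp: sol_ex_deriv_def indicator_def\<close>)
  also have "\<dots> = real n / 2 * (LINT t:{1<..<jump_time n}|lborel. \<phi> t)"
    by (simp add: set_lebesgue_integral_def)
  also have "(LINT t:{1<..<jump_time n}|lborel. \<phi> t) = integral {1<..<jump_time n} \<phi>"
    by (rule set_borel_integral_eq_integral,
        rule set_integrable_subset[OF borel_integrable_atLeastAtMost'[OF \<phi>(2)]]) auto
  finally have 1: "(LINT t|fst (load_ex_deriv n). \<phi> t) = real n / 2 * integral {1..jump_time n} \<phi>"
    by (simp add: integral_open_interval_real)
  have "(LINT t|snd (load_ex_deriv n). \<phi> t) =
      (LINT t|point_measure ({jump_time n} \<inter> {0<..<2}) (\<lambda>_. ennreal (1 / 2)). \<phi> t)"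
    unfolding load_ex_deriv_def snd_conv
    by (rule integral_distr[OF _ meas])
      (auto simp: measurable_def space_point_measure sets_point_measure space_restrict_space)
  also have "\<dots> = (\<Sum>t\<in>{jump_time n} \<inter> {0<..<2}. (1 / 2) *\<^sub>R \<phi> t)"
    by (rule lebesgue_integral_point_measure_finite) auto
  also have "\<dots> = (if jump_time n < 2 then \<phi> (jump_time n) / 2 else 0)"
    using jump_time_bounds(1)[OF n] by (auto simp: Int_insert_left)
  finally show ?thesis using 1 by (simp add: signed_integral_def)
qed

lemma load_ex_has_BV_derivative:
  assumes n: "n \<ge> 1"
  shows "has_BV_derivative 2 (load_ex n) (load_ex_deriv n)"
  unfolding has_BV_derivative_def
proof (intro conjI ballI load_ex_deriv_signed_measure)
  have "integrable (lebesgue_on {0<..<2})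
      (\<lambda>t. indicator UNIV t * sol_ex n t - indicator {jump_time n..} t * (1 / 2))"
    by (intro Bochner_Integration.integrable_diff integrable_indicator_continuous
        continuous_intros continuous_sol_ex n) auto
  thus "integrable (lebesgue_on {0<..<2}) (load_ex n)"
    by (simp add: load_ex_eq[OF n, abs_def])
next
  fix \<phi> assume \<phi>: "\<phi> \<in> test_functions 2"
  have "(LINT t|lebesgue_on {0<..<2}. load_ex n t * deriv \<phi> t) =
      1 / 2 * \<phi> (jump_time n) - real n / 2 * integral {1..jump_time n} \<phi>"
    using LINT_mult_deriv_test[OF n \<phi>, of "1 / 2"] by (simp add: load_ex_eq[OF n])
  thus "(LINT t|lebesgue_on {0<..<2}. load_ex n t * deriv \<phi> t) = - signed_integral (load_ex_deriv n) \<phi>"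
    using signed_integral_load_ex_deriv[OF n test_functionsD(2,2)[OF \<phi>]]
      test_functionsD(4)[OF \<phi>, of "jump_time n"] by auto
qed

section \<open>Weak* convergence of the loads\<close>

text \<open>Since the length of \<open>(1,c)\<close> is \<open>1/n\<close>, the mean value of \<open>\<phi>\<close> over it is the difference quotient
  at \<open>1\<close> of the primitive of \<open>\<phi>\<close>, and so tends to \<open>\<phi> 1\<close>, which is also the limit of \<open>\<phi> c\<close>.\<close>

lemma signed_integral_load_ex_deriv_tendsto:
  assumes "continuous_on {0<..<2} \<phi>"
  shows "(\<lambda>n. signed_integral (load_ex_deriv (Suc n)) \<phi>) \<longlonglongrightarrow> 0"
proof -
  define \<Phi> where "\<Phi> u = integral {1..u} \<phi>" for u
  have cont: "continuous_on {1..3 / 2} \<phi>"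
    by (rule continuous_on_subset[OF assms]) auto
  have ev: "eventually (\<lambda>n. jump_time (Suc n) < 3 / 2) sequentially"
    by (rule eventually_jump_time_less) simp
  have at: "filterlim (\<lambda>n. jump_time (Suc n)) (at 1 within {1..3 / 2}) sequentially"
  proof (unfold filterlim_at, intro conjI jump_time_tendsto)
    show "eventually (\<lambda>n. jump_time (Suc n) \<in> {1..3 / 2} \<and> jump_time (Suc n) \<noteq> 1) sequentially"
      using ev
    proof eventually_elim
      case (elim n)
      thus ?case using jump_time_bounds(1)[of "Suc n"] by simp
    qed
  qed
  have "(\<Phi> has_vector_derivative \<phi> 1) (at 1 within {1..3 / 2})"
    unfolding \<Phi>_def by (rule integral_has_vector_derivative[OF cont]) simp
  hence "((\<lambda>u. (\<Phi> u - \<Phi> 1) / (u - 1)) \<longlongrightarrow> \<phi> 1) (at 1 within {1..3 / 2})"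
    by (simp add: has_field_derivative_iff flip: has_real_derivative_iff_has_vector_derivative)
  from filterlim_compose[OF this at]
  have "(\<lambda>n. real (Suc n) * \<Phi> (jump_time (Suc n))) \<longlonglongrightarrow> \<phi> 1"
    by (simp add: \<Phi>_def jump_time_def mult.commute)
  moreover have "(\<lambda>n. \<phi> (jump_time (Suc n))) \<longlonglongrightarrow> \<phi> 1"
    by (rule filterlim_compose[OF _ at]) (use cont in \<open>auto simp: continuous_on_def\<close>)
  ultimately have "(\<lambda>n. (real (Suc n) * \<Phi> (jump_time (Suc n)) - \<phi> (jump_time (Suc n))) / 2)
      \<longlonglongrightarrow> (\<phi> 1 - \<phi> 1) / 2"
    by (intro tendsto_intros) simp_all
  moreover have "eventually (\<lambda>n. signed_integral (load_ex_deriv (Suc n)) \<phi> =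
      (real (Suc n) * \<Phi> (jump_time (Suc n)) - \<phi> (jump_time (Suc n))) / 2) sequentially"
    using ev
  proof eventually_elim
    case (elim n)
    have "continuous_on {1..jump_time (Suc n)} \<phi>"
      by (rule continuous_on_subset[OF cont]) (use elim in auto)
    from signed_integral_load_ex_deriv[OF _ assms this] elim show ?case
      by (simp add: \<Phi>_def diff_divide_distrib)
  qed
  ultimately show ?thesis by (subst tendsto_cong) (assumption, simp)
qed

lemma load_ex_L1_tendsto: "(\<lambda>n. LINT t|lebesgue_on {0<..<2}. \<bar>load_ex (Suc n) t\<bar>) \<longlonglongrightarrow> 0"
proof -
  have "(\<lambda>n. LINT t|lebesgue_on {0<..<2}. \<bar>load_ex (Suc n) t\<bar>) \<longlonglongrightarrow> (LINT t|lebesgue_on {0<..<2::real}. 0)"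
  proof (rule integral_dominated_convergence[where w="\<lambda>_. 1 / 2"])
    show "(\<lambda>t. \<bar>load_ex (Suc n) t\<bar>) \<in> borel_measurable (lebesgue_on {0<..<2})" for n
      using load_ex_has_BV_derivative[of "Suc n"] by (auto simp: has_BV_derivative_def)
    show "integrable (lebesgue_on {0<..<2::real}) (\<lambda>_. 1 / 2 :: real)"
      using integrable_indicator_continuous[of "\<lambda>_. 1 / 2" UNIV 0 2] by simp
    show "AE t in lebesgue_on {0<..<2}. (\<lambda>n. \<bar>load_ex (Suc n) t\<bar>) \<longlonglongrightarrow> 0"
      by (intro AE_I2 tendsto_rabs_zero load_ex_tendsto)
    show "AE t in lebesgue_on {0<..<2}. norm \<bar>load_ex (Suc n) t\<bar> \<le> 1 / 2" for n
    proof (rule AE_I2)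
      fix t show "norm \<bar>load_ex (Suc n) t\<bar> \<le> 1 / 2"
        using sol_ex_bounds[of "Suc n" t] by (simp add: load_ex_eq indicator_def)
    qed
  qed simp
  thus ?thesis by simp
qed

lemma load_ex_weak_star: "weak_star_BV 2 (\<lambda>n. load_ex (Suc n)) (\<lambda>t. 0)"
  unfolding weak_star_BV_def
proof (intro exI conjI allI)
  let ?N = "null_measure (restrict_space borel {0<..<2::real})"
  show "has_BV_derivative 2 (load_ex (Suc n)) (load_ex_deriv (Suc n))" for n
    by (rule load_ex_has_BV_derivative) simp
  have "finite_measure ?N" by (rule finite_measureI) simp
  thus "has_BV_derivative 2 (\<lambda>t. 0) (?N, ?N)"
    by (simp add: has_BV_derivative_def signed_integral_def signed_measures_def)
  show "(\<lambda>n. LINT t|lebesgue_on {0<..<2}. \<bar>load_ex (Suc n) t - 0\<bar>) \<longlonglongrightarrow> 0"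
    using load_ex_L1_tendsto by simp
  show "weak_star_meas 2 (\<lambda>n. load_ex_deriv (Suc n)) (?N, ?N)"
    using signed_integral_load_ex_deriv_tendsto
    by (auto simp: weak_star_meas_def C0_def signed_integral_def)
qed

section \<open>The instability example\<close>

theorem mainTheorem2:
  shows
    \<comment> \<open>sequences over \<open>n \<ge> 1\<close> are indexed by \<open>Suc n\<close>\<close>
    "((\<forall>n. load_ex (Suc n) \<in> BV 2) \<and>
      (\<forall>t\<in>{0..2}. (\<lambda>n. load_ex (Suc n) t) \<longlonglongrightarrow> 0) \<and>
      weak_star_BV 2 (\<lambda>n. load_ex (Suc n)) (\<lambda>t. 0)) \<and>
     (\<forall>n\<ge>1.
        (\<exists>v. has_W1inf_derivative 2 (sol_ex n) v \<and>
             (AE t in lebesgue_on {0<..<2}.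
                0 \<in> (\<lambda>\<xi>. \<xi> + deriv E_ex (sol_ex n t) - load_ex n t) ` subdifferential R_ex (v t))) \<and>
        sol_ex n 0 = 0 \<and>
        local_solution R_ex E_ex 2 (load_ex n) (sol_ex n)) \<and>
     (\<forall>t\<in>{0..2}. (\<lambda>n. sol_ex (Suc n) t) \<longlonglongrightarrow> lim_ex t) \<and>
     (lim_ex \<in> BV 2 \<and> \<not> local_solution R_ex E_ex 2 (\<lambda>t. 0) lim_ex) \<and>
     \<not> local_solutions_weak_star_stable R_ex E_ex 2"
proof -
  have zero: "(\<lambda>t. 0) \<in> BV 2" by (rule BV_I[where G="\<lambda>t. 0"]) simp
  have "\<not> local_solutions_weak_star_stable R_ex E_ex 2"
  proof
    assume "local_solutions_weak_star_stable R_ex E_ex 2"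
    from this[unfolded local_solutions_weak_star_stable_def, rule_format,
        of "\<lambda>n. load_ex (Suc n)" "\<lambda>t. 0" "\<lambda>n. sol_ex (Suc n)" lim_ex]
    have "local_solution R_ex E_ex 2 (\<lambda>t. 0) lim_ex"
      using zero load_ex_BV load_ex_weak_star sol_ex_local_solution lim_ex_BV sol_ex_tendsto
      by simp
    thus False using lim_ex_not_local_solution by contradiction
  qed
  moreover have "\<exists>v. has_W1inf_derivative 2 (sol_ex n) v \<and>
      (AE t in lebesgue_on {0<..<2}.
         0 \<in> (\<lambda>\<xi>. \<xi> + deriv E_ex (sol_ex n t) - load_ex n t) ` subdifferential R_ex (v t))"
    if "n \<ge> 1" for n
    using sol_ex_W1inf[OF that] sol_ex_inclusion[OF that] by (intro exI[of _ "sol_ex_deriv n"]) simp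
  moreover have "sol_ex n 0 = 0" for n by (simp add: sol_ex_def)
  ultimately show ?thesis
    using load_ex_BV load_ex_tendsto load_ex_weak_star sol_ex_local_solution sol_ex_tendsto
      lim_ex_BV lim_ex_not_local_solution by simp
qed

end
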